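(* Let $G$ be a graph, let $\pi = \{W_1,\dots,W_k\}$ be a clique vertex-partition of $G$, and let $r \geq 1$. Then the $r$-independence complex $\mathrm{Ind}_r(G^\pi_r)$ of the $r$-clique whiskering $G^\pi_r$ is shellable.
   Context: All graphs are finite and simple. A clique vertex-partition of $G$ is a collection $\pi=\{W_1,\dots,W_k\}$ of pairwise disjoint cliques of $G$ (some possibly empty) with $\bigcup_i W_i = V(G)$. Given $r \ge 1$, the $r$-clique whiskering $G^\pi_r$ is defined by choosing integers $t_i \geq r$ for $1\le i\le k$, adding new vertices $x_{i,1},\dots,x_{i,t_i}$ for each $i$, and adding all edges needed so that $W_i \cup \{x_{i,1},\dots,x_{i,t_i}\}$ is a clique for each $i$; i.e. $V(G^\pi_r) = V(G)\cup\bigcup_i\{x_{i,1},\dots,x_{i,t_i}\}$ and $E(G^\pi_r) = E(G)\cup\bigcup_i\{\{a,b\} : a\ne b,\ a,b\in W_i\cup\{x_{i,1},\dots,x_{i,t_i}\}\}$. For $r \geq 1$, a subset $A$ of the vertex set is $r$-independent if every connected component of the induced subgraph on $A$ has at most $r$ vertices; $\mathrm{Ind}_r(\cdot)$ is the simplicial complex of all $r$-independent subsets. A (not necessarily pure) simplicial complex is shellable if its facets can be ordered $F_1,\dots,F_s$ so that for each $j>1$, $\langle F_j\rangle \cap \langle F_1,\dots,F_{j-1}\rangle$ is pure of dimension $\dim F_j-1$ ($\langle\mathcal F\rangle$ = complex generated by $\mathcal F$). *)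

theory Defs
  imports "Graph_Theory.Graph_Theory"
begin

section \<open>Graphs\<close>

text \<open>Finite simple graphs are the structures satisfying \<open>pair_graph\<close>: finite digraphs without
  loops and parallel arcs whose arc relation is symmetric, the edge \<open>{a, b}\<close> being the pair of
  arcs \<open>(a, b)\<close>, \<open>(b, a)\<close>.\<close>

definition is_clique :: "'a pair_pre_digraph \<Rightarrow> 'a set \<Rightarrow> bool" where
  "is_clique G W \<longleftrightarrow> W \<subseteq> pverts G \<and> (\<forall>a\<in>W. \<forall>b\<in>W. a \<noteq> b \<longrightarrow> (a, b) \<in> parcs G)"

text \<open>The family \<open>W 1, \<dots>, W k\<close> is disjoint as an indexed family, so that \<open>{}\<close> may occur several
  times. Values of \<open>W\<close> outside \<open>{1..k}\<close> are irrelevant.\<close>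

definition clique_vertex_partition :: "'a pair_pre_digraph \<Rightarrow> nat \<Rightarrow> (nat \<Rightarrow> 'a set) \<Rightarrow> bool" where
  "clique_vertex_partition G k W \<longleftrightarrow>
     (\<forall>i\<in>{1..k}. is_clique G (W i)) \<and>
     (\<forall>i\<in>{1..k}. \<forall>j\<in>{1..k}. i \<noteq> j \<longrightarrow> W i \<inter> W j = {}) \<and>
     (\<Union>i\<in>{1..k}. W i) = pverts G"

text \<open>In the whiskering, \<open>Inl v\<close> is the old vertex \<open>v\<close> and \<open>Inr (i, j)\<close> is the new vertex
  \<open>x\<^bsub>i,j\<^esub>\<close>.\<close>

definition new_verts :: "(nat \<Rightarrow> nat) \<Rightarrow> nat \<Rightarrow> ('a + nat \<times> nat) set" where
  "new_verts t i = (\<lambda>j. Inr (i, j)) ` {1..t i}"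

definition clique_whiskering ::
    "'a pair_pre_digraph \<Rightarrow> nat \<Rightarrow> (nat \<Rightarrow> 'a set) \<Rightarrow> (nat \<Rightarrow> nat) \<Rightarrow> ('a + nat \<times> nat) pair_pre_digraph"
  where
  "clique_whiskering G k W t =
     \<lparr> pverts = Inl ` pverts G \<union> (\<Union>i\<in>{1..k}. new_verts t i),
       parcs = {(Inl a, Inl b) | a b. (a, b) \<in> parcs G} \<union>
         (\<Union>i\<in>{1..k}. {(a, b). a \<noteq> b \<and> a \<in> Inl ` W i \<union> new_verts t i \<and> b \<in> Inl ` W i \<union> new_verts t i}) \<rparr>"

definition connected_components :: "('a, 'b) pre_digraph \<Rightarrow> ('a, 'b) pre_digraph set" where
  "connected_components G = {C. pre_digraph.max_subgraph G connected C}"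

definition r_independent :: "nat \<Rightarrow> 'a pair_pre_digraph \<Rightarrow> 'a set \<Rightarrow> bool" where
  "r_independent r G A \<longleftrightarrow>
     A \<subseteq> pverts G \<and> (\<forall>C \<in> connected_components (with_proj G \<restriction> A). card (verts C) \<le> r)"

definition Ind :: "nat \<Rightarrow> 'a pair_pre_digraph \<Rightarrow> 'a set set" where
  "Ind r G = {A. r_independent r G A}"


section \<open>Simplicial complexes\<close>

definition simplicial_complex :: "'a set set \<Rightarrow> bool" where
  "simplicial_complex K \<longleftrightarrow> finite (\<Union>K) \<and> {} \<in> K \<and> (\<forall>A\<in>K. \<forall>B. B \<subseteq> A \<longrightarrow> B \<in> K)"

definition facets :: "'a set set \<Rightarrow> 'a set set" where
  "facets K = {F\<in>K. \<forall>A\<in>K. F \<subseteq> A \<longrightarrow> A = F}"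

text \<open>The empty face has dimension \<open>-1\<close>.\<close>

definition face_dim :: "'a set \<Rightarrow> int" where
  "face_dim A = int (card A) - 1"

definition pure_of_dim :: "'a set set \<Rightarrow> int \<Rightarrow> bool" where
  "pure_of_dim K d \<longleftrightarrow> facets K \<noteq> {} \<and> (\<forall>F\<in>facets K. face_dim F = d)"

definition generated_complex :: "'a set set \<Rightarrow> 'a set set" where
  "generated_complex S = {A. \<exists>F\<in>S. A \<subseteq> F}"

text \<open>List positions start at \<open>0\<close>: \<open>Fs ! j\<close> is the facet \<open>F\<^bsub>j+1\<^esub>\<close>, and \<open>take j Fs\<close> lists
  the facets before it.\<close>

definition shelling :: "'a set set \<Rightarrow> 'a set list \<Rightarrow> bool" where
  "shelling K Fs \<longleftrightarrow> distinct Fs \<and> set Fs = facets K \<and>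
     (\<forall>j. 0 < j \<and> j < length Fs \<longrightarrow>
        pure_of_dim (generated_complex {Fs ! j} \<inter> generated_complex (set (take j Fs)))
          (face_dim (Fs ! j) - 1))"

definition shellable :: "'a set set \<Rightarrow> bool" where
  "shellable K \<longleftrightarrow> simplicial_complex K \<and> (\<exists>Fs. shelling K Fs)"


section \<open>Well-formedness\<close>

lemma pair_graph_clique_whiskering:
  assumes "pair_graph G" and "clique_vertex_partition G k W"
  shows "pair_graph (clique_whiskering G k W t)"
proof -
  interpret pair_graph G by fact
  have W: "W i \<subseteq> pverts G" if "i \<in> {1..k}" for i
    using assms(2) that by (auto simp: clique_vertex_partition_def)
  let ?H = "clique_whiskering G k W t"
  have V: "finite (pverts ?H)"
    using pair_finite_verts by (simp add: clique_whiskering_def new_verts_def)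
  have sub: "parcs ?H \<subseteq> pverts ?H \<times> pverts ?H"
    using W by (fastforce simp: clique_whiskering_def dest: in_arcsD1 in_arcsD2)
  have fin: "finite (parcs ?H)" using finite_subset[OF sub] V by simp
  have sy: "sym (parcs ?H)"
    using pair_sym_arcs unfolding clique_whiskering_def symmetric_def
    by (auto intro!: symI dest: symD)
  show ?thesis
  proof
    show "fst e \<in> pverts ?H" "snd e \<in> pverts ?H" if "e \<in> parcs ?H" for e
      using that sub by auto
    show "finite (pverts ?H)" "finite (parcs ?H)" by fact+
    show "fst e \<noteq> snd e" if "e \<in> parcs ?H" for e
      using that no_loops by (fastforce simp: clique_whiskering_def dest: pair_no_loops)
    show "symmetric (with_proj ?H)" using sy by (simp add: symmetric_def)
  qed
qed

lemma simplicial_complex_Ind: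
  assumes "pair_graph G"
  shows "simplicial_complex (Ind r G)"
proof -
  interpret pair_graph G by fact
  have fin: "finite (\<Union>(Ind r G))"
    by (rule finite_subset[OF _ pair_finite_verts]) (auto simp: Ind_def r_independent_def)
  have "r_independent r G {}"
    by (auto simp: r_independent_def connected_components_def pre_digraph.max_subgraph_def subgraph_def)
  moreover have "r_independent r G B" if A: "r_independent r G A" and "B \<subseteq> A" for A B
    unfolding r_independent_def
  proof (intro conjI ballI)
    have AV: "A \<subseteq> pverts G" using A by (simp add: r_independent_def)
    show "B \<subseteq> pverts G" using AV \<open>B \<subseteq> A\<close> by simp
    fix C assume "C \<in> connected_components (with_proj G \<restriction> B)"
    then have C: "subgraph C (with_proj G \<restriction> B)" "connected C"
      by (auto simp: connected_components_def pre_digraph.max_subgraph_def)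
    have "subgraph (with_proj G \<restriction> B) (with_proj G \<restriction> A)"
      using \<open>B \<subseteq> A\<close> AV by (auto simp: subgraph_def compatible_def intro!: wellformed_induce_subgraph)
    with C have CA: "subgraph C (with_proj G \<restriction> A)" by (meson subgraph_trans)
    let ?m = "\<lambda>D. card (verts D) + card (arcs D)"
    let ?P = "\<lambda>D. subgraph C D \<and> subgraph D (with_proj G \<restriction> A) \<and> connected D"
    have fA: "finite A" using AV pair_finite_verts finite_subset by blast
    have bnd: "finite (verts D) \<and> finite (arcs D) \<and> ?m D \<le> card A + card (parcs G)"
      if "subgraph D (with_proj G \<restriction> A)" for D
    proof -
      from that have "verts D \<subseteq> A" "arcs D \<subseteq> parcs G" by (auto simp: subgraph_def)
      with fA pair_finite_arcs show ?thesis
        by (meson add_mono card_mono finite_subset)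
    qed
    have "?P C" using C CA by (auto simp: subgraph_def compatible_def)
    then obtain D where D: "?P D" and max: "\<And>D'. ?P D' \<Longrightarrow> ?m D' \<le> ?m D"
      using ex_has_greatest_nat[of ?P C ?m "card A + card (parcs G) + 1"] bnd
      by (metis (no_types, lifting) le_imp_less_Suc Suc_eq_plus1 less_imp_le)
    have "D \<in> connected_components (with_proj G \<restriction> A)"
      unfolding connected_components_def pre_digraph.max_subgraph_def mem_Collect_eq
    proof (intro conjI allI impI notI)
      fix D' assume 1: "D' \<noteq> D \<and> subgraph D D'" and 2: "subgraph D' (with_proj G \<restriction> A) \<and> connected D'"
      then have "?P D'" using D by (meson subgraph_trans)
      then have le: "?m D' \<le> ?m D" by (rule max)
      have s: "verts D \<subseteq> verts D'" "arcs D \<subseteq> arcs D'" and t: "tail D = tail D'" "head D = head D'"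
        using 1 by (auto simp: subgraph_def compatible_def)
      have f: "finite (verts D')" "finite (arcs D')" using bnd 2 by auto
      have "card (verts D) \<le> card (verts D')" "card (arcs D) \<le> card (arcs D')"
        using s f by (auto intro: card_mono)
      with le have "card (verts D') = card (verts D)" "card (arcs D') = card (arcs D)" by auto
      then have "verts D = verts D'" "arcs D = arcs D'"
        using s f by (simp_all add: card_subset_eq)
      with t have "D = D'" by simp
      with 1 show False by simp
    qed (use D in auto)
    then have "card (verts D) \<le> r" using A by (simp add: r_independent_def)
    moreover have "card (verts C) \<le> card (verts D)"
      using D bnd by (intro card_mono) (auto simp: subgraph_def)
    ultimately show "card (verts C) \<le> r" by simp
  qed
  ultimately show ?thesis using fin by (auto simp: simplicial_complex_def Ind_def)
qed

end

(* Write X for the set of new vertices. Two facts drive the proof. The neighbours of a new vertex x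
   are adjacent or equal to every other vertex of the clique of x, so x may replace any such vertex
   in an r-independent set; as there are at least r new vertices in every clique, a set that is
   maximal with respect to adding new vertices is a facet. Hence every face extends to a facet by
   new vertices alone. Order the facets F by the number of old vertices they contain, and
   lexicographically by X - F among those with equally many. If F' precedes F, then either some old
   vertex v of F is missing in F', and F - v extends by new vertices to an earlier facet, or F and F'
   have the same old vertices, and a matroid-like exchange at the first difference gives the earlier
   facet. *)

theory Submission
  imports Defs
begin

section \<open>A criterion for shellability\<close>

lemma ex_facet_above:
  assumes "finite K" "A \<in> K"
  shows "\<exists>F\<in>facets K. A \<subseteq> F"
proof -
  obtain F where "F \<in> K" "A \<subseteq> F" "\<And>B. B \<in> K \<Longrightarrow> F \<subseteq> B \<Longrightarrow> F = B"
    using finite_has_maximal2[OF assms] by metis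
  then show ?thesis unfolding facets_def by blast
qed

text \<open>Sort the facets by \<open>key\<close>. As \<open>key F' \<le> key F\<close> includes
  ties, the exchange covers every earlier \<open>F'\<close>, and the strict
  \<open>key F'' < key F\<close> places \<open>F''\<close> before \<open>F\<close> however ties are
  broken. A facet of the intersection thus lies in some \<open>F - {x}\<close>, which is a face of
  it, and so equals that face.\<close>

lemma shelling_if_key:
  fixes key :: "'a set \<Rightarrow> 'b :: linorder"
  assumes fin: "finite K" "\<And>A. A \<in> K \<Longrightarrow> finite A"
    and exchange: "\<And>F F'. F \<in> facets K \<Longrightarrow> F' \<in> facets K \<Longrightarrow> F' \<noteq> F \<Longrightarrow> key F' \<le> key F \<Longrightarrow>
      \<exists>x\<in>F - F'. \<exists>F''\<in>facets K. key F'' < key F \<and> F - {x} \<subseteq> F''"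
  shows "\<exists>Fs. shelling K Fs"
proof -
  have "finite (facets K)" using fin(1) by (simp add: facets_def)
  then obtain L where L: "set L = facets K" "distinct L" using finite_distinct_list by blast
  define Fs where "Fs = sort_key key L"
  have Fs: "set Fs = facets K" "distinct Fs" "sorted (map key Fs)"
    using L by (simp_all add: Fs_def)
  have mono: "key (Fs ! i) \<le> key (Fs ! j)" if "i \<le> j" "j < length Fs" for i j
    using sorted_nth_mono[OF Fs(3), of i j] that by simp
  have "pure_of_dim (generated_complex {Fs ! j} \<inter> generated_complex (set (take j Fs)))
          (face_dim (Fs ! j) - 1)" (is "pure_of_dim ?I _")
    if j: "0 < j" "j < length Fs" for j
    unfolding pure_of_dim_def
  proof (intro conjI ballI)
    let ?F = "Fs ! j"
    have F: "?F \<in> facets K" using j Fs(1) nth_mem by blast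
    have finF: "finite ?F" using F fin(2) by (simp add: facets_def)
    have "?I \<subseteq> Pow ?F" by (auto simp: generated_complex_def)
    then have finI: "finite ?I" using finF by (meson finite_Pow_iff finite_subset)
    have "Fs ! 0 \<in> set (take j Fs)" using j by (auto simp: in_set_conv_nth)
    then have "{} \<in> ?I" by (auto simp: generated_complex_def)
    from ex_facet_above[OF finI this] show "facets ?I \<noteq> {}" by blast
    fix A assume A: "A \<in> facets ?I"
    then obtain i where i: "i < j" "A \<subseteq> Fs ! i" and AF: "A \<subseteq> ?F"
      using j by (auto simp: facets_def generated_complex_def in_set_conv_nth)
    have "Fs ! i \<in> facets K" using i j Fs(1) nth_mem by (metis order.strict_trans)
    moreover have "Fs ! i \<noteq> ?F" using i j Fs(2) by (simp add: nth_eq_iff_index_eq)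
    moreover have "key (Fs ! i) \<le> key ?F" using mono i j by simp
    ultimately obtain x F'' where x: "x \<in> ?F - Fs ! i" and F'': "F'' \<in> facets K"
      "key F'' < key ?F" "?F - {x} \<subseteq> F''"
      using exchange[OF F] by blast
    obtain l where l: "l < length Fs" "Fs ! l = F''" using F''(1) Fs(1) by (metis in_set_conv_nth)
    have "l < j" using mono[of j l] l F''(2) by (meson leD leI)
    then have "F'' \<in> set (take j Fs)" using l by (auto simp: in_set_conv_nth)
    then have "?F - {x} \<in> ?I" using F''(3) by (auto simp: generated_complex_def)
    moreover have "A \<subseteq> ?F - {x}" using AF i x by auto
    ultimately have A_eq: "A = ?F - {x}" using A unfolding facets_def by blast
    have "card ?F = Suc (card (?F - {x}))"
      using card.remove[OF finF, of x] x by blast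
    then show "face_dim A = face_dim ?F - 1" by (simp add: face_dim_def A_eq)
  qed
  then have "shelling K Fs" unfolding shelling_def using Fs(1,2) by blast
  then show ?thesis by blast
qed

section \<open>Binary weights\<close>

lemma sum_pow2_less:
  fixes h :: "'a \<Rightarrow> nat"
  assumes "inj_on h A" "\<And>x. x \<in> A \<Longrightarrow> h x < n"
  shows "(\<Sum>x\<in>A. 2 ^ h x) < (2 ^ n :: nat)"
proof -
  have "(\<Sum>x\<in>A. 2 ^ h x) = (\<Sum>i\<in>h ` A. 2 ^ i :: nat)" using assms(1) by (simp add: sum.reindex)
  also have "\<dots> \<le> (\<Sum>i<n. 2 ^ i)" using assms(2) by (intro sum_mono2) auto
  also have "\<dots> < 2 ^ n" by (induction n) auto
  finally show ?thesis .
qed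

text \<open>Two binary numbers are compared at the highest digit in which they differ, and the
  larger one owns that digit.\<close>

lemma sum_pow2_le_imp_max_diff:
  fixes h :: "'a \<Rightarrow> nat"
  assumes "finite A" "finite B" "inj_on h (A \<union> B)" "A \<noteq> B"
    and le: "(\<Sum>x\<in>A. 2 ^ h x) \<le> (\<Sum>x\<in>B. 2 ^ h x :: nat)"
  obtains y where "y \<in> B - A" "\<And>x. x \<in> A - B \<Longrightarrow> h x < h y"
proof -
  let ?D = "(A - B) \<union> (B - A)"
  let ?s = "\<lambda>S. \<Sum>x\<in>S. 2 ^ h x :: nat"
  have D: "finite ?D" "?D \<noteq> {}" using assms by auto
  have "Max (h ` ?D) \<in> h ` ?D" using D by (intro Max_in) auto
  then obtain y where y: "y \<in> ?D" "h y = Max (h ` ?D)" by (metis imageE)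
  have max: "h x \<le> h y" if "x \<in> ?D" for x using that D y(2) by simp
  have less: "h x < h y" if "x \<in> ?D" "x \<noteq> y" for x
    using max[OF that(1)] inj_onD[OF assms(3), of x y] that y(1) by fastforce
  have "y \<notin> A"
  proof
    assume "y \<in> A"
    then have yAB: "y \<in> A - B" using y(1) by blast
    then have "\<And>x. x \<in> B - A \<Longrightarrow> h x < h y" using less by blast
    \<comment> \<open>All digits of \<open>B - A\<close> together stay below the single digit
      \<open>y\<close> of \<open>A\<close>; the common part \<open>A \<inter> B\<close>
      cancels.\<close>
    then have "?s (B - A) < 2 ^ h y"
      by (intro sum_pow2_less) (auto intro: inj_on_subset[OF assms(3)])
    also have "\<dots> \<le> ?s (A - B)" using yAB assms(1) by (intro member_le_sum) auto
    finally have "?s (B - A) + ?s (A \<inter> B) < ?s (A - B) + ?s (A \<inter> B)" by simp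
    moreover have "?s A = ?s (A - B) + ?s (A \<inter> B)" "?s B = ?s (B - A) + ?s (A \<inter> B)"
      using assms by (simp_all add: sum.Int_Diff[of A _ B] sum.Int_Diff[of B _ A] Int_commute)
    ultimately show False using le by simp
  qed
  then show ?thesis using that y(1) less by blast
qed

section \<open>Connected vertex sets\<close>

text \<open>Connectedness of the induced subgraph as paths inside \<open>C\<close>, free of digraph
  records. The empty set counts as connected, so deleting a vertex from a singleton is no
  exception.\<close>

definition conn_set :: "('a \<times> 'a) set \<Rightarrow> 'a set \<Rightarrow> bool" where
  "conn_set E C \<longleftrightarrow> (\<forall>a\<in>C. \<forall>b\<in>C. (a, b) \<in> (E \<inter> C \<times> C)\<^sup>*)"

lemma conn_set_empty: "conn_set E {}"
  by (simp add: conn_set_def)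

lemma conn_set_clique:
  assumes "\<And>a b. a \<in> C \<Longrightarrow> b \<in> C \<Longrightarrow> a \<noteq> b \<Longrightarrow> (a, b) \<in> E"
  shows "conn_set E C"
  unfolding conn_set_def
proof (intro ballI)
  fix a b assume "a \<in> C" "b \<in> C"
  then show "(a, b) \<in> (E \<inter> C \<times> C)\<^sup>*" using assms by (cases "a = b") auto
qed

text \<open>Edges go to edges or collapse to a point, so paths go to paths.\<close>

lemma conn_set_image:
  assumes "conn_set E C"
    and "\<And>a b. a \<in> C \<Longrightarrow> b \<in> C \<Longrightarrow> (a, b) \<in> E \<Longrightarrow> f a = f b \<or> (f a, f b) \<in> E"
  shows "conn_set E (f ` C)"
proof -
  have "(f a, f b) \<in> (E \<inter> f ` C \<times> f ` C)\<^sup>*" if "(a, b) \<in> (E \<inter> C \<times> C)\<^sup>*" for a b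
    using that
  proof induction
    case (step b c)
    then have "f b = f c \<or> (f b, f c) \<in> E \<inter> f ` C \<times> f ` C" using assms(2) by blast
    then show ?case using step.IH by (metis rtrancl.rtrancl_into_rtrancl)
  qed simp
  then show ?thesis using assms(1) by (simp add: conn_set_def)
qed

lemma conn_set_Un:
  assumes "conn_set E C" "conn_set E D" "y \<in> C" "y \<in> D"
  shows "conn_set E (C \<union> D)"
proof -
  let ?R = "E \<inter> (C \<union> D) \<times> (C \<union> D)"
  have "(E \<inter> C \<times> C)\<^sup>* \<subseteq> ?R\<^sup>*" "(E \<inter> D \<times> D)\<^sup>* \<subseteq> ?R\<^sup>*" by (rule rtrancl_mono; blast)+
  then have "(a, y) \<in> ?R\<^sup>* \<and> (y, a) \<in> ?R\<^sup>*" if "a \<in> C \<union> D" for a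
    using that assms unfolding conn_set_def by blast
  then show ?thesis unfolding conn_set_def by (meson rtrancl_trans)
qed

lemma conn_set_neighbour:
  assumes "conn_set E C" "y \<in> C" "C \<noteq> {y}"
  obtains z where "z \<in> C" "(y, z) \<in> E"
proof -
  obtain b where "b \<in> C" "b \<noteq> y" using assms by blast
  then have "(y, b) \<in> (E \<inter> C \<times> C)\<^sup>*" using assms by (simp add: conn_set_def)
  then obtain z where "(y, z) \<in> E" "z \<in> C"
    using \<open>b \<noteq> y\<close> by (cases rule: converse_rtranclE) auto
  then show ?thesis using that by blast
qed

text \<open>A component spans a connected set, which gives one direction. For the other, a connected
  nonempty \<open>C\<close> inside \<open>A\<close> is r-independent by closure under subsets, and
  its induced subgraph is its own component; so no component of \<open>A\<close> around
  \<open>C\<close> has to be built.\<close>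

lemma r_independent_iff_conn_set:
  assumes "pair_graph G"
  shows "r_independent r G A \<longleftrightarrow>
    A \<subseteq> pverts G \<and> (\<forall>C. C \<subseteq> A \<and> conn_set (parcs G) C \<longrightarrow> card C \<le> r)"
proof -
  interpret pair_graph G by fact
  have sym: "sym (parcs G)" using pair_sym_arcs by (simp add: symmetric_def)
  show ?thesis
  proof (intro iffI conjI allI impI)
    assume "r_independent r G A"
    then show "A \<subseteq> pverts G" by (simp add: r_independent_def)
    fix C assume C: "C \<subseteq> A \<and> conn_set (parcs G) C"
    then have CV: "C \<subseteq> pverts G" using \<open>A \<subseteq> pverts G\<close> by blast
    have C_ind: "r_independent r G C"
      using \<open>r_independent r G A\<close> C simplicial_complex_Ind[OF assms, of r]
      unfolding simplicial_complex_def Ind_def by blast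
    show "card C \<le> r"
    proof (cases "C = {}")
      case False
      let ?H = "with_proj G \<restriction> C"
      let ?R = "parcs G \<inter> C \<times> C"
      have R: "?R \<subseteq> (arcs_ends ?H)\<^sup>s" by (auto simp: arcs_ends_conv symcl_def)
      have "(a, b) \<in> rtrancl_on C ((arcs_ends ?H)\<^sup>s)"
        if "(a, b) \<in> ?R\<^sup>*" "a \<in> C" "b \<in> C" for a b
      proof -
        have "(a, b) \<in> rtrancl_on C ?R" using that by (rule rtrancl_consistent_rtrancl_on) blast
        then show ?thesis by (rule rtrancl_on_mono[OF R order_refl])
      qed
      then have "connected ?H"
        using False C by (auto simp: connected_conv conn_set_def)
      moreover have "wf_digraph ?H" using CV by (intro wellformed_induce_subgraph)
      moreover from this have "subgraph ?H ?H" by (rule wf_digraph.subgraph_refl)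
      moreover have "D = ?H" if "subgraph ?H D" "subgraph D ?H" for D
      proof (rule pre_digraph.equality)
        show "verts D = verts ?H" "arcs D = arcs ?H"
          using that unfolding subgraph_def by blast+
        show "tail D = tail ?H" "head D = head ?H"
          using that unfolding subgraph_def compatible_def by metis+
      qed simp
      ultimately have "?H \<in> connected_components ?H"
        unfolding connected_components_def pre_digraph.max_subgraph_def by blast
      then have "card (verts ?H) \<le> r" using C_ind unfolding r_independent_def by blast
      then show ?thesis by simp
    qed simp
  next
    assume R: "A \<subseteq> pverts G \<and> (\<forall>C. C \<subseteq> A \<and> conn_set (parcs G) C \<longrightarrow> card C \<le> r)"
    show "r_independent r G A"
      unfolding r_independent_def
    proof (intro conjI ballI)
      fix D assume "D \<in> connected_components (with_proj G \<restriction> A)"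
      then have D: "subgraph D (with_proj G \<restriction> A)" "connected D"
        by (auto simp: connected_components_def pre_digraph.max_subgraph_def)
      have "verts D \<subseteq> A" using D(1) by (simp add: subgraph_def)
      moreover have "conn_set (parcs G) (verts D)"
      proof -
        have "(arcs_ends D)\<^sup>s \<subseteq> parcs G \<inter> verts D \<times> verts D"
        proof (rule subrelI)
          fix a b assume "(a, b) \<in> (arcs_ends D)\<^sup>s"
          then have ab: "(a, b) \<in> arcs_ends D \<or> (b, a) \<in> arcs_ends D" by (auto simp: symcl_def)
          have "arcs_ends D \<subseteq> arcs_ends (with_proj G \<restriction> A)" using D(1) by (rule arcs_ends_mono)
          then have "arcs_ends D \<subseteq> parcs G" by (auto simp: arcs_ends_conv)
          then have "(a, b) \<in> parcs G" using ab sym by (meson subsetD symD)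
          moreover have "wf_digraph D" using D(1) by (simp add: subgraph_def)
          then have "a \<in> verts D" "b \<in> verts D"
            using ab wf_digraph.adj_in_verts[of D a b] wf_digraph.adj_in_verts[of D b a] by metis+
          ultimately show "(a, b) \<in> parcs G \<inter> verts D \<times> verts D" by blast
        qed
        then have "((arcs_ends D)\<^sup>s)\<^sup>* \<subseteq> (parcs G \<inter> verts D \<times> verts D)\<^sup>*" by (rule rtrancl_mono)
        then show ?thesis
          using D(2) rtrancl_on_sub_rtrancl unfolding connected_conv conn_set_def by blast
      qed
      ultimately show "card (verts D) \<le> r" using R by blast
    qed (use R in blast)
  qed
qed

section \<open>Graphs with whiskered cliques\<close>

text \<open>What the argument needs of a clique whiskering: \<open>X\<close> holds the new vertices
  and \<open>blk\<close> names the clique of a vertex. Only new vertices have their neighbours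
  confined to their clique; old ones may have edges across cliques.\<close>

locale whiskered =
  fixes V X :: "'a set" and E :: "('a \<times> 'a) set" and blk :: "'a \<Rightarrow> 'b" and r :: nat
  assumes fin: "finite V" and X_sub: "X \<subseteq> V"
    and sym: "sym E" and irrefl: "(a, a) \<notin> E" and E_sub: "E \<subseteq> V \<times> V"
    and blk_clique: "a \<in> V \<Longrightarrow> b \<in> V \<Longrightarrow> blk a = blk b \<Longrightarrow> a \<noteq> b \<Longrightarrow> (a, b) \<in> E"
    and blk_X: "x \<in> X \<Longrightarrow> (x, b) \<in> E \<Longrightarrow> blk b = blk x"
    and card_blk: "v \<in> V \<Longrightarrow> r \<le> card {x \<in> X. blk x = blk v}"
begin

definition indep :: "'a set set" where
  "indep = {A. A \<subseteq> V \<and> (\<forall>C. C \<subseteq> A \<and> conn_set E C \<longrightarrow> card C \<le> r)}"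

lemma indep_subset: "A \<in> indep \<Longrightarrow> B \<subseteq> A \<Longrightarrow> B \<in> indep"
  unfolding indep_def by blast

lemma indep_sub: "A \<in> indep \<Longrightarrow> A \<subseteq> V"
  by (simp add: indep_def)

lemma card_le_if_indep: "A \<in> indep \<Longrightarrow> C \<subseteq> A \<Longrightarrow> conn_set E C \<Longrightarrow> card C \<le> r"
  by (simp add: indep_def)

lemma finite_in_indep: "A \<in> indep \<Longrightarrow> finite A"
  using fin finite_subset indep_sub by blast

lemma finite_indep: "finite indep"
  by (rule finite_subset[of _ "Pow V"]) (use indep_sub fin in auto)

lemma not_indepE:
  assumes "insert x A \<notin> indep" "A \<in> indep" "x \<in> V"
  obtains C where "C \<subseteq> insert x A" "conn_set E C" "r < card C" "x \<in> C"
proof -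
  obtain C where "C \<subseteq> insert x A" "conn_set E C" "r < card C"
    using assms unfolding indep_def by (auto simp: not_le)
  moreover from this have "\<not> C \<subseteq> A" using assms(2) unfolding indep_def by auto
  ultimately show ?thesis using that by blast
qed

text \<open>Every neighbour of \<open>x\<close> lies in its clique and so equals \<open>v\<close> or
  is adjacent to it. Hence the move keeps or collapses each edge; \<open>v\<close> may already be in
  \<open>C\<close>.\<close>

lemma conn_set_move_whisker:
  assumes "conn_set E C" "x \<in> X" "v \<in> V" "blk v = blk x"
  shows "conn_set E ((\<lambda>a. if a = x then v else a) ` C)"
proof (rule conn_set_image[OF assms(1)])
  have xb: "b = v \<or> (v, b) \<in> E" if "(x, b) \<in> E" for b
    using that blk_X[OF assms(2)] blk_clique[of v b] E_sub assms by force
  then have "a = v \<or> (a, v) \<in> E" if "(a, x) \<in> E" for a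
    using that sym by (meson symD)
  then show "(if a = x then v else a) = (if b = x then v else b) \<or>
      (if a = x then v else a, if b = x then v else b) \<in> E" if "(a, b) \<in> E" for a b
    using that xb by auto
qed

text \<open>A new vertex is never a cut vertex: moving it onto a neighbour in \<open>C\<close>
  deletes it from \<open>C\<close>.\<close>

lemma conn_set_remove_whisker:
  assumes "conn_set E C" "y \<in> X" "C \<subseteq> V"
  shows "conn_set E (C - {y})"
proof (cases "y \<in> C \<and> C \<noteq> {y}")
  case True
  then obtain z where z: "z \<in> C" "z \<noteq> y" "(y, z) \<in> E"
    using conn_set_neighbour[OF assms(1)] irrefl by metis
  have "(\<lambda>a. if a = y then z else a) ` C = C - {y}" using z by force
  then show ?thesis
    using conn_set_move_whisker[OF assms(1,2), of z] z assms(3) blk_X[OF assms(2) z(3)] by auto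
next
  case False
  then have "C - {y} = C \<or> C - {y} = {}" by blast
  then show ?thesis using assms(1) conn_set_empty[of E] by (elim disjE) (simp_all only:)
qed

text \<open>Moving \<open>x\<close> to \<open>v\<close> would carry a connected subset of
  \<open>insert x B\<close> with more than \<open>r\<close> vertices onto one of
  \<open>insert v B\<close> of the same size.\<close>

lemma replace_by_whisker:
  assumes "insert v B \<in> indep" "x \<in> X" "blk v = blk x" "v \<notin> B"
  shows "insert x B \<in> indep"
proof (rule ccontr)
  assume nin: "insert x B \<notin> indep"
  have v: "v \<in> V" using indep_sub[OF assms(1)] by blast
  have "B \<in> indep" using assms(1) by (rule indep_subset) blast
  moreover have "x \<in> V" using assms(2) X_sub by blast
  ultimately obtain C where C: "C \<subseteq> insert x B" "conn_set E C" "r < card C"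
    using nin by (rule_tac not_indepE)
  let ?f = "\<lambda>a. if a = x then v else a"
  have "?f ` C \<subseteq> insert v B" using C(1) by auto
  then have "card (?f ` C) \<le> r"
    using conn_set_move_whisker[OF C(2) assms(2) v assms(3)] by (rule card_le_if_indep[OF assms(1)])
  \<comment> \<open>\<open>v\<close> can occur in \<open>C\<close> only if \<open>v = x\<close>, so
    the move identifies no two vertices.\<close>
  moreover have "v \<notin> C - {x}" using C(1) assms(4) by blast
  then have "inj_on ?f C" unfolding inj_on_def by (simp split: if_splits)
  then have "card (?f ` C) = card C" by (rule card_image)
  ultimately show False using C(3) by linarith
qed

text \<open>If some \<open>v\<close> could be added, then by replacement so could each new vertex of
  its clique; these are therefore all in \<open>F\<close>. There are at least \<open>r\<close> of
  them, so with \<open>v\<close> they form a clique of more than \<open>r\<close> vertices.\<close>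

lemma facet_if_no_whisker_addable:
  assumes F: "F \<in> indep" and no_whisker: "\<And>x. x \<in> X \<Longrightarrow> insert x F \<in> indep \<Longrightarrow> x \<in> F"
  shows "F \<in> facets indep"
proof -
  have "B \<subseteq> F" if B: "B \<in> indep" "F \<subseteq> B" for B
  proof
    fix v assume "v \<in> B"
    then have vF: "insert v F \<in> indep" using B by (intro indep_subset[OF B(1)]) auto
    have vV: "v \<in> V" using \<open>v \<in> B\<close> indep_sub[OF B(1)] by (rule rev_subsetD)
    show "v \<in> F"
    proof (rule ccontr)
      assume v: "v \<notin> F"
      let ?Q = "{x \<in> X. blk x = blk v}"
      have Q: "?Q \<subseteq> F"
      proof
        fix x assume "x \<in> ?Q"
        then have "x \<in> X" "blk v = blk x" by simp_all
        then show "x \<in> F" using replace_by_whisker[OF vF _ _ v] no_whisker by simp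
      qed
      then have "insert v ?Q \<subseteq> insert v F" by (rule insert_mono)
      moreover have "conn_set E (insert v ?Q)"
      proof (rule conn_set_clique)
        fix a b assume "a \<in> insert v ?Q" "b \<in> insert v ?Q" "a \<noteq> b"
        moreover from this have "a \<in> V" "b \<in> V" using vV X_sub by auto
        ultimately show "(a, b) \<in> E" using blk_clique by auto
      qed
      ultimately have "card (insert v ?Q) \<le> r" by (rule card_le_if_indep[OF vF])
      moreover have "finite ?Q" using Q finite_in_indep[OF F] by (rule finite_subset)
      moreover have "v \<notin> ?Q" using Q v by blast
      ultimately show False using card_blk[OF vV] by simp
    qed
  qed
  then show ?thesis using F unfolding facets_def by (simp add: subset_antisym)
qed

text \<open>A maximal face among those obtained from \<open>A\<close> by adding new vertices admits
  no further one, hence is a facet of the whole complex.\<close>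

lemma extend_by_whiskers:
  assumes "A \<in> indep"
  obtains F where "F \<in> facets indep" "A \<subseteq> F" "F - A \<subseteq> X"
proof -
  define K where "K = {B \<in> indep. A \<subseteq> B \<and> B - A \<subseteq> X}"
  have "finite K" "A \<in> K" using finite_indep assms by (simp_all add: K_def)
  then obtain F where F: "F \<in> K" and max: "\<And>B. B \<in> K \<Longrightarrow> F \<subseteq> B \<Longrightarrow> F = B"
    using finite_has_maximal2[of K A] by metis
  have "x \<in> F" if "x \<in> X" "insert x F \<in> indep" for x
  proof -
    have "insert x F \<in> K" using F that by (auto simp: K_def)
    then have "F = insert x F" using max by blast
    then show ?thesis by blast
  qed
  then have "F \<in> facets indep" using F facet_if_no_whisker_addable by (simp add: K_def)
  then show ?thesis using that F by (simp add: K_def)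
qed

text \<open>Adding \<open>y\<close> to \<open>F\<close> creates a connected \<open>C\<close> with
  more than \<open>r\<close> vertices. It acts like a fundamental circuit of a matroid: removing any
  vertex of \<open>C\<close> outside \<open>F'\<close> restores independence. Such a vertex is new,
  since \<open>F\<close> and \<open>F'\<close> agree on old vertices.\<close>

lemma whisker_exchange:
  assumes "F \<in> facets indep" "F' \<in> indep" "F - X = F' - X" "y \<in> X" "y \<in> F' - F"
  obtains x where "x \<in> X" "x \<in> F - F'" "insert y (F - {x}) \<in> indep"
proof -
  have F: "F \<in> indep" and "insert y F \<notin> indep" using assms by (auto simp: facets_def)
  then obtain C where C: "C \<subseteq> insert y F" "conn_set E C" "r < card C" "y \<in> C"
    using not_indepE assms(4) X_sub by blast
  have "\<not> C \<subseteq> F'" using card_le_if_indep[OF assms(2)] C(2,3) by (meson leD)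
  then obtain x where x: "x \<in> C" "x \<notin> F'" by blast
  then have xF: "x \<in> X" "x \<in> F - F'" using C(1) assms by blast+
  have "insert y (F - {x}) \<in> indep"
  proof (rule ccontr)
    assume "insert y (F - {x}) \<notin> indep"
    moreover have "F - {x} \<in> indep" using F indep_subset by blast
    ultimately obtain D where D: "D \<subseteq> insert y (F - {x})" "conn_set E D" "r < card D" "y \<in> D"
      using not_indepE assms(4) X_sub by blast
    (* Without y, the union of C and D is a connected subset of F; so it has at most r + 1 elements
       together with y, which forces it to be D, although x is not in D. *)
    let ?U = "C \<union> D"
    have U: "?U \<subseteq> insert y F" using C(1) D(1) by blast
    have "insert y F \<subseteq> V" using indep_sub[OF F] assms(4) X_sub by blast
    then have "conn_set E (?U - {y})"
      using U by (intro conn_set_remove_whisker conn_set_Un[OF C(2) D(2) C(4) D(4)] assms(4)) auto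
    moreover have "?U - {y} \<subseteq> F" using U by blast
    ultimately have "card (?U - {y}) \<le> r" using card_le_if_indep[OF F] by blast
    moreover have finU: "finite ?U" using U finite_in_indep[OF F] finite_subset by blast
    ultimately have "card ?U \<le> card D" using D(3,4) by (simp add: card_Diff_singleton)
    then have "D = ?U" using finU by (intro card_seteq) auto
    then show False using x(1,2) D(1) assms(5) by blast
  qed
  then show ?thesis using that xF by blast
qed

section \<open>The shelling order\<close>

lemma indep_shelling: "\<exists>Fs. shelling indep Fs"
proof -
  have finX: "finite X" using fin X_sub finite_subset by blast
  from finite_imp_inj_to_nat_seg[OF this]
  obtain h :: "'a \<Rightarrow> nat" and n where h: "h ` X = {i. i < n}" "inj_on h X" by metis
  \<comment> \<open>\<open>X - F\<close> read as a binary number, with digit positions from the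
    enumeration \<open>h\<close>. Through the complement, facets holding high new vertices come
    first.\<close>
  define weight :: "'a set \<Rightarrow> nat" where "weight F = (\<Sum>x\<in>X - F. 2 ^ h x)" for F
  \<comment> \<open>As \<open>weight\<close> stays below \<open>2 ^ n\<close>, the number of old
    vertices decides and \<open>weight\<close> only breaks ties.\<close>
  define key where "key F = card (F - X) * 2 ^ n + weight F" for F
  have weight_less: "weight F < 2 ^ n" for F
    unfolding weight_def
  proof (rule sum_pow2_less)
    show "inj_on h (X - F)" using h(2) by (rule inj_on_subset) blast
    show "h x < n" if "x \<in> X - F" for x using that h(1) by blast
  qed
  \<comment> \<open>Complements swap the roles: the set of smaller weight contains the highest new
    vertex in which the two differ.\<close>
  have weight_le: "\<exists>y\<in>X \<inter> A - B. \<forall>x\<in>X \<inter> B - A. h x < h y"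
    if "weight A \<le> weight B" "X \<inter> A \<noteq> X \<inter> B" for A B
  proof (rule sum_pow2_le_imp_max_diff)
    show "finite (X - A)" "finite (X - B)" using finX by simp_all
    show "inj_on h ((X - A) \<union> (X - B))" using h(2) by (rule inj_on_subset) blast
    show "(\<Sum>x\<in>X - A. 2 ^ h x) \<le> (\<Sum>x\<in>X - B. 2 ^ h x :: nat)"
      using that(1) by (simp add: weight_def)
    show "X - A \<noteq> X - B" using that(2) by blast
    fix y assume y: "y \<in> (X - B) - (X - A)" "\<And>x. x \<in> (X - A) - (X - B) \<Longrightarrow> h x < h y"
    show ?thesis
    proof (intro bexI ballI)
      show "h x < h y" if "x \<in> X \<inter> B - A" for x using that by (intro y(2)) blast
    qed (use y(1) in blast)
  qed
  have key_less: "key F < key F'" if "card (F - X) < card (F' - X)" for F F'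
  proof -
    have "key F < Suc (card (F - X)) * 2 ^ n" using weight_less[of F] by (simp add: key_def)
    also have "\<dots> \<le> card (F' - X) * 2 ^ n" using that by (intro mult_right_mono) auto
    finally show ?thesis by (simp add: key_def)
  qed
  show ?thesis
  proof (rule shelling_if_key[of _ key])
    fix F F' assume F: "F \<in> facets indep" and F': "F' \<in> facets indep" and "F' \<noteq> F"
      and le: "key F' \<le> key F"
    have ind: "F \<in> indep" "F' \<in> indep" using F F' by (auto simp: facets_def)
    then have finF: "finite F" "finite F'" using finite_in_indep by auto
    have card_le: "card (F' - X) \<le> card (F - X)" using key_less le by (meson leD leI)
    show "\<exists>x\<in>F - F'. \<exists>F''\<in>facets indep. key F'' < key F \<and> F - {x} \<subseteq> F''"
    proof (cases "F - X \<subseteq> F' - X")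
      case False
      then obtain v where v: "v \<in> F" "v \<notin> X" "v \<notin> F'" by blast
      have "F - {v} \<in> indep" using ind(1) by (rule indep_subset) blast
      then obtain F'' where F'': "F'' \<in> facets indep" "F - {v} \<subseteq> F''" "F'' - (F - {v}) \<subseteq> X"
        by (rule extend_by_whiskers)
      \<comment> \<open>Only new vertices refill \<open>F - {v}\<close>, so an old vertex is lost
        and \<open>key\<close> drops whatever the weight.\<close>
      have "F'' - X = F - X - {v}" using F'' v by blast
      then have "card (F'' - X) < card (F - X)"
        using v finF card_Diff1_less[of "F - X" v] by simp
      then have "key F'' < key F" by (rule key_less)
      then show ?thesis using F''(1,2) v(1,3) by blast
    next
      case True
      then have eq: "F - X = F' - X" using card_le finF by (intro card_seteq) auto
      then have "weight F' \<le> weight F" using le by (simp add: key_def)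
      moreover have "X \<inter> F' \<noteq> X \<inter> F" using eq \<open>F' \<noteq> F\<close> by (metis Int_commute Int_Diff_Un)
      ultimately obtain y where y: "y \<in> X \<inter> F' - F" and max: "\<forall>x\<in>X \<inter> F - F'. h x < h y"
        using weight_le by meson
      have "y \<in> X" "y \<in> F' - F" using y by blast+
      then obtain x where x: "x \<in> X" "x \<in> F - F'" and xy: "insert y (F - {x}) \<in> indep"
        by (rule whisker_exchange[OF F ind(2) eq])
      obtain F'' where F'': "F'' \<in> facets indep" "insert y (F - {x}) \<subseteq> F''"
        "F'' - insert y (F - {x}) \<subseteq> X"
        using xy by (rule extend_by_whiskers)
      have "x \<notin> F''"
      proof
        assume "x \<in> F''"
        then have "F \<subseteq> F''" using F''(2) by blast
        then have "F'' = F" using F F''(1) by (auto simp: facets_def)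
        then show False using F''(2) \<open>y \<in> F' - F\<close> by blast
      qed
      have old: "F'' - X = F - X" using F'' x y by blast
      have hx: "h x < h y" using max x by blast
      \<comment> \<open>\<open>F''\<close> loses only \<open>x\<close> from \<open>F\<close> and
        gains \<open>y\<close>, which ranks higher. Were the weight not smaller, the highest
        difference would lie in \<open>F - F''\<close>, hence be \<open>x\<close>.\<close>
      have "weight F'' < weight F"
      proof (rule ccontr)
        assume "\<not> weight F'' < weight F"
        then have "weight F \<le> weight F''" by simp
        moreover have y_in: "y \<in> X \<inter> F'' - F" using y F''(2) by blast
        then have "X \<inter> F \<noteq> X \<inter> F''" by blast
        ultimately obtain z where z: "z \<in> X \<inter> F - F''" and "\<forall>u\<in>X \<inter> F'' - F. h u < h z"
          using weight_le by meson
        then have "h y < h z" using y_in by blast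
        moreover have "z = x" using z F''(2) by blast
        ultimately show False using hx by simp
      qed
      then have "key F'' < key F" using old by (simp add: key_def)
      moreover have "F - {x} \<subseteq> F''" using F''(2) by blast
      ultimately show ?thesis using x(2) F''(1) by blast
    qed
  qed (rule finite_indep, erule finite_in_indep)
qed

end

section \<open>Clique whiskerings as whiskered graphs\<close>

theorem theorem5p4:
  fixes G :: "'a pair_pre_digraph" and W :: "nat \<Rightarrow> 'a set" and t :: "nat \<Rightarrow> nat"
    and k r :: nat
  assumes "pair_graph G"
    and "clique_vertex_partition G k W"
    and "r \<ge> 1"
    and "\<forall>i\<in>{1..k}. t i \<ge> r"
  shows "shellable (Ind r (clique_whiskering G k W t))"
proof -
  let ?H = "clique_whiskering G k W t"
  let ?X = "\<Union>i\<in>{1..k}. new_verts t i"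
  have H: "pair_graph ?H" using assms(1,2) by (rule pair_graph_clique_whiskering)
  interpret H: pair_graph ?H by fact
  have arcs_H: "parcs ?H = {(Inl a, Inl b) | a b. (a, b) \<in> parcs G} \<union>
      (\<Union>i\<in>{1..k}. {(a, b). a \<noteq> b \<and> a \<in> Inl ` W i \<union> new_verts t i \<and> b \<in> Inl ` W i \<union> new_verts t i})"
    by (simp add: clique_whiskering_def)
  have W: "\<And>i. i \<in> {1..k} \<Longrightarrow> is_clique G (W i)" "(\<Union>i\<in>{1..k}. W i) = pverts G"
    and disj: "\<And>i j. i \<in> {1..k} \<Longrightarrow> j \<in> {1..k} \<Longrightarrow> i \<noteq> j \<Longrightarrow> W i \<inter> W j = {}"
    using assms(2) by (auto simp: clique_vertex_partition_def)
  \<comment> \<open>For a vertex of \<open>G\<close> the choice is unique, as the cliques cover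
    \<open>G\<close> and are disjoint.\<close>
  define part where "part v = (SOME i. i \<in> {1..k} \<and> v \<in> W i)" for v
  have part: "part v \<in> {1..k} \<and> v \<in> W (part v)" if "v \<in> pverts G" for v
    unfolding part_def by (rule someI_ex) (use that W(2) in blast)
  have part_eq: "part v = i" if "i \<in> {1..k}" "v \<in> W i" for v i
  proof -
    have "v \<in> pverts G" using that W(2) by blast
    then show ?thesis using part[of v] disj[of i "part v"] that by blast
  qed
  define blk :: "'a + nat \<times> nat \<Rightarrow> nat" where "blk = case_sum part fst"
  have in_blk: "blk a \<in> {1..k} \<and> a \<in> Inl ` W (blk a) \<union> new_verts t (blk a)"
    if "a \<in> pverts ?H" for a
  proof (cases a)
    case (Inl v)
    then have "v \<in> pverts G" using that by (auto simp: clique_whiskering_def new_verts_def)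
    then show ?thesis using part[of v] Inl by (simp add: blk_def)
  next
    case (Inr p)
    then show ?thesis using that by (auto simp: blk_def clique_whiskering_def new_verts_def)
  qed
  have blk_eq: "blk a = i" if "i \<in> {1..k}" "a \<in> Inl ` W i \<union> new_verts t i" for a i
  proof (cases a)
    case (Inl v)
    then have "v \<in> W i" using that(2) by (auto simp: new_verts_def)
    then show ?thesis using part_eq[OF that(1)] Inl by (simp add: blk_def)
  next
    case (Inr p)
    then show ?thesis using that(2) by (auto simp: blk_def new_verts_def)
  qed
  interpret whiskered "pverts ?H" ?X "parcs ?H" blk r
  proof
    show "finite (pverts ?H)" by (rule H.pair_finite_verts)
    show "?X \<subseteq> pverts ?H" by (auto simp: clique_whiskering_def)
    show "sym (parcs ?H)" using H.pair_sym_arcs by (simp add: symmetric_def)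
    show "(a, a) \<notin> parcs ?H" for a using H.pair_no_loops[of "(a, a)"] by auto
    show "parcs ?H \<subseteq> pverts ?H \<times> pverts ?H" by (auto dest: H.in_arcsD1 H.in_arcsD2)
    show "(a, b) \<in> parcs ?H"
      if "a \<in> pverts ?H" "b \<in> pverts ?H" "blk a = blk b" "a \<noteq> b" for a b
    proof -
      have "blk a \<in> {1..k}" "a \<in> Inl ` W (blk a) \<union> new_verts t (blk a)"
        "b \<in> Inl ` W (blk a) \<union> new_verts t (blk a)"
        using in_blk[OF that(1)] in_blk[OF that(2)] that(3) by auto
      then have "(a, b) \<in> (\<Union>i\<in>{1..k}. {(a, b). a \<noteq> b \<and>
          a \<in> Inl ` W i \<union> new_verts t i \<and> b \<in> Inl ` W i \<union> new_verts t i})"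
        using that(4) by blast
      then show ?thesis using arcs_H by blast
    qed
    show "blk b = blk x" if x: "x \<in> ?X" "(x, b) \<in> parcs ?H" for x b
    proof -
      \<comment> \<open>A new vertex is no endpoint of an arc of \<open>G\<close>, so its arcs all
        come from the enlarged cliques.\<close>
      have "(x, b) \<notin> {(Inl a, Inl b) | a b. (a, b) \<in> parcs G}"
        using x(1) by (auto simp: new_verts_def)
      then have "(x, b) \<in> (\<Union>i\<in>{1..k}. {(a, b). a \<noteq> b \<and>
          a \<in> Inl ` W i \<union> new_verts t i \<and> b \<in> Inl ` W i \<union> new_verts t i})"
        using x(2) arcs_H by blast
      then obtain i where "i \<in> {1..k}" "x \<in> Inl ` W i \<union> new_verts t i"
        "b \<in> Inl ` W i \<union> new_verts t i" by blast
      then show ?thesis using blk_eq[of i x] blk_eq[of i b] by simp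
    qed
    show "r \<le> card {x \<in> ?X. blk x = blk v}" if "v \<in> pverts ?H" for v
    proof -
      have i: "blk v \<in> {1..k}" using in_blk[OF that] by blast
      \<comment> \<open>The new vertices in the clique of \<open>v\<close> are exactly the
        \<open>t (blk v)\<close> attached ones, and \<open>t (blk v) \<ge> r\<close>.\<close>
      have "{x \<in> ?X. blk x = blk v} = new_verts t (blk v)"
        using i by (auto simp: blk_def new_verts_def)
      moreover have "card (new_verts t (blk v)) = t (blk v)"
        unfolding new_verts_def by (subst card_image) (auto intro: inj_onI)
      ultimately show ?thesis using i assms(4) by metis
    qed
  qed
  have "Ind r ?H = indep"
    by (simp add: Ind_def indep_def r_independent_iff_conn_set[OF H])
  then show ?thesis
    unfolding shellable_def using simplicial_complex_Ind[OF H, of r] indep_shelling by simp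
qed

end
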